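(* For every integer $r\ge 2$, \textsc{D$r$DSR} under $\mathsf{TS}$ on (connected) split graphs is solvable in polynomial time. Moreover, for $r=2$: for any connected split graph $G=(K\uplus S,E)$ and any two D$2$DSs $D_s,D_t$ of $G$ of the same size $k$, there is a $\mathsf{TS}$-sequence in $G$ between $D_s$ and $D_t$.
   Context: Graphs are finite, simple, undirected, and (as a standing assumption of the paper) connected. A split graph $G=(K\uplus S,E)$ has vertex set partitioned into a clique $K$ and an independent set $S$. For an integer $r\ge1$, a D$r$DS of $G$ is a set $D\subseteq V(G)$ such that every vertex is at distance at most $r$ from some vertex of $D$. A $\mathsf{TS}$-sequence between D$r$DSs $D_s,D_t$ is a sequence $D_s=D_0,\dots,D_q=D_t$ of D$r$DSs such that for each $i$, $D_i\setminus D_{i+1}=\{x_i\}$, $D_{i+1}\setminus D_i=\{y_i\}$ and $x_iy_i\in E(G)$. \textsc{D$r$DSR} under $\mathsf{TS}$: given $G$ and D$r$DSs $D_s,D_t$, decide whether a $\mathsf{TS}$-sequence between them exists. *)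

theory Defs
  imports "Graph_Theory.Graph_Theory" "HOL-Computational_Algebra.Polynomial"
begin

text \<open>A finite simple undirected graph is a \<^locale>\<open>pair_graph\<close>: an edge \<open>uv\<close> is the pair of arcs
  \<open>(u, v)\<close>, \<open>(v, u)\<close>.\<close>

definition clique :: "'a pair_pre_digraph \<Rightarrow> 'a set \<Rightarrow> bool" where
  "clique G K \<longleftrightarrow> K \<subseteq> pverts G \<and> (\<forall>u\<in>K. \<forall>v\<in>K. u \<noteq> v \<longrightarrow> (u, v) \<in> parcs G)"

definition independent_set :: "'a pair_pre_digraph \<Rightarrow> 'a set \<Rightarrow> bool" where
  "independent_set G S \<longleftrightarrow> S \<subseteq> pverts G \<and> (\<forall>u\<in>S. \<forall>v\<in>S. (u, v) \<notin> parcs G)"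

definition split_partition :: "'a pair_pre_digraph \<Rightarrow> 'a set \<Rightarrow> 'a set \<Rightarrow> bool" where
  "split_partition G K S \<longleftrightarrow>
     K \<union> S = pverts G \<and> K \<inter> S = {} \<and> clique G K \<and> independent_set G S"

definition split_graph :: "'a pair_pre_digraph \<Rightarrow> bool" where
  "split_graph G \<longleftrightarrow> (\<exists>K S. split_partition G K S)"

text \<open>Shortest-path cost with unit arc weights; it is \<open>\<infinity>\<close> when there is no walk.\<close>

definition graph_dist :: "'a pair_pre_digraph \<Rightarrow> 'a \<Rightarrow> 'a \<Rightarrow> ereal" where
  "graph_dist G u v = wf_digraph.\<mu> (with_proj G) (\<lambda>_. 1) u v"

definition is_DrDS :: "'a pair_pre_digraph \<Rightarrow> nat \<Rightarrow> 'a set \<Rightarrow> bool" where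
  "is_DrDS G r D \<longleftrightarrow>
     D \<subseteq> pverts G \<and> (\<forall>v\<in>pverts G. \<exists>u\<in>D. graph_dist G u v \<le> ereal (real r))"

text \<open>The sequence is \<open>D 0, \<dots>, D q\<close>; values of \<open>D\<close> beyond \<open>q\<close> are irrelevant.\<close>

definition TS_sequence ::
    "'a pair_pre_digraph \<Rightarrow> nat \<Rightarrow> 'a set \<Rightarrow> 'a set \<Rightarrow> nat \<Rightarrow> (nat \<Rightarrow> 'a set) \<Rightarrow> bool" where
  "TS_sequence G r Ds Dt q D \<longleftrightarrow>
     D 0 = Ds \<and> D q = Dt \<and> (\<forall>i\<le>q. is_DrDS G r (D i)) \<and>
     (\<forall>i<q. \<exists>x y. D i - D (Suc i) = {x} \<and> D (Suc i) - D i = {y} \<and> (x, y) \<in> parcs G)"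

definition TS_reconfigurable ::
    "'a pair_pre_digraph \<Rightarrow> nat \<Rightarrow> 'a set \<Rightarrow> 'a set \<Rightarrow> bool" where
  "TS_reconfigurable G r Ds Dt \<longleftrightarrow> (\<exists>q D. TS_sequence G r Ds Dt q D)"

text \<open>States and tape symbols are initial segments of the naturals. State 0 is the start state,
  1 accepts, 2 rejects; symbol 0 is the blank. Tapes are infinite in both directions.\<close>

datatype move = MoveLeft | Stay | MoveRight

fun offset :: "move \<Rightarrow> int" where
  "offset MoveLeft = -1"
| "offset Stay = 0"
| "offset MoveRight = 1"

record tm =
  ntapes :: nat
  nsymbols :: nat
  nstates :: nat
  delta :: "nat \<Rightarrow> nat list \<Rightarrow> nat \<times> (nat \<times> move) list"

text \<open>Only the values of \<open>delta\<close> on the finitely many state/symbol combinations below matter, so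
  \<open>delta\<close> is a finite transition table.\<close>

definition wf_tm :: "tm \<Rightarrow> bool" where
  "wf_tm M \<longleftrightarrow> 1 \<le> ntapes M \<and> 1 \<le> nsymbols M \<and> 3 \<le> nstates M \<and>
     (\<forall>q<nstates M. \<forall>xs. length xs = ntapes M \<and> set xs \<subseteq> {..<nsymbols M} \<longrightarrow>
        fst (delta M q xs) < nstates M \<and>
        length (snd (delta M q xs)) = ntapes M \<and>
        fst ` set (snd (delta M q xs)) \<subseteq> {..<nsymbols M})"

type_synonym tape = "(int \<Rightarrow> nat) \<times> int"
type_synonym config = "nat \<times> tape list"

definition read_tape :: "tape \<Rightarrow> nat" where
  "read_tape t = fst t (snd t)"

definition write_move :: "nat \<times> move \<Rightarrow> tape \<Rightarrow> tape" where
  "write_move a t = ((fst t)(snd t := fst a), snd t + offset (snd a))"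

definition halted :: "config \<Rightarrow> bool" where
  "halted c \<longleftrightarrow> fst c = 1 \<or> fst c = 2"

definition tm_step :: "tm \<Rightarrow> config \<Rightarrow> config" where
  "tm_step M c =
     (if halted c then c
      else let (q, as) = delta M (fst c) (map read_tape (snd c))
           in (q, map2 write_move as (snd c)))"

definition input_tape :: "nat list \<Rightarrow> tape" where
  "input_tape w = ((\<lambda>i. if 0 \<le> i \<and> i < int (length w) then w ! nat i else 0), 0)"

definition tm_init :: "tm \<Rightarrow> nat list \<Rightarrow> config" where
  "tm_init M w = (0, input_tape w # replicate (ntapes M - 1) (input_tape []))"

definition tm_run :: "tm \<Rightarrow> nat list \<Rightarrow> nat \<Rightarrow> config" where
  "tm_run M w t = (tm_step M ^^ t) (tm_init M w)"

text \<open>Nothing is required of the machine on words that do not encode an element of the instance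
  set \<open>I\<close>: restricting a problem to a class of inputs is a promise.\<close>

definition poly_time_solvable :: "'i set \<Rightarrow> ('i \<Rightarrow> nat list) \<Rightarrow> ('i \<Rightarrow> bool) \<Rightarrow> bool" where
  "poly_time_solvable I enc Q \<longleftrightarrow>
     (\<exists>M (p :: nat poly). wf_tm M \<and>
        (\<forall>x\<in>I. set (enc x) \<subseteq> {0<..<nsymbols M} \<and>
           (\<exists>t \<le> poly p (length (enc x)).
              halted (tm_run M (enc x) t) \<and>
              (fst (tm_run M (enc x) t) = 1 \<longleftrightarrow> Q x))))"

type_synonym instance_DrDSR = "nat pair_pre_digraph \<times> nat set \<times> nat set"

text \<open>As inputs to an algorithm, graphs have vertex set \<open>{0, \<dots>, n - 1}\<close>.\<close>

definition split_DrDSR_instances :: "nat \<Rightarrow> instance_DrDSR set" where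
  "split_DrDSR_instances r =
     {(G, Ds, Dt). pair_graph G \<and> (\<exists>n. pverts G = {..<n}) \<and>
        Digraph_Component.connected (with_proj G) \<and> split_graph G \<and>
        is_DrDS G r Ds \<and> is_DrDS G r Dt}"

text \<open>Instances are written as the adjacency matrix of \<open>G\<close> followed by the characteristic vectors
  of \<open>Ds\<close> and \<open>Dt\<close>. Symbols 1 and 2 are the bits zero and one, 3 ends a row of the matrix and 4 ends
  each of the three parts.\<close>

definition bit_symbol :: "bool \<Rightarrow> nat" where
  "bit_symbol b = (if b then 2 else 1)"

definition encode_graph :: "nat pair_pre_digraph \<Rightarrow> nat list" where
  "encode_graph G =
     (let n = card (pverts G)
      in concat (map (\<lambda>u. map (\<lambda>v. bit_symbol ((u, v) \<in> parcs G)) [0..<n] @ [3]) [0..<n]))"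

definition encode_vertex_set :: "nat \<Rightarrow> nat set \<Rightarrow> nat list" where
  "encode_vertex_set n D = map (\<lambda>v. bit_symbol (v \<in> D)) [0..<n]"

definition encode_DrDSR :: "instance_DrDSR \<Rightarrow> nat list" where
  "encode_DrDSR = (\<lambda>(G, Ds, Dt).
     encode_graph G @ [4] @
     encode_vertex_set (card (pverts G)) Ds @ [4] @
     encode_vertex_set (card (pverts G)) Dt @ [4])"

definition split_DrDSR_poly_time :: "nat \<Rightarrow> bool" where
  "split_DrDSR_poly_time r \<longleftrightarrow>
     poly_time_solvable (split_DrDSR_instances r) encode_DrDSR
       (\<lambda>(G, Ds, Dt). TS_reconfigurable G r Ds Dt)"

end

theory Submission
  imports Defs
begin

text \<open>
  Let \<open>r \<ge> 2\<close> and let \<open>G = (K \<uplus> S, E)\<close> be connected with at least two vertices. Every vertex of \<open>S\<close>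
  has a neighbour in \<open>K\<close>, so every vertex set that meets \<open>K\<close> is a D\<open>r\<close>DS, and a D\<open>r\<close>DS inside \<open>S\<close>
  meets \<open>K\<close> after one slide. Among the sets that meet \<open>K\<close>, any token can be exchanged for any
  unoccupied vertex by a few slides, as long as the result meets \<open>K\<close> too; the missing vertices of
  the target can therefore be filled one by one. Hence for every \<open>r \<ge> 2\<close> the answer depends on
  \<open>|D\<^sub>s| = |D\<^sub>t|\<close> alone, which a Turing machine decides in one pass over the input, using the head
  position on a second tape as a counter.
\<close>

section \<open>Reconfiguration sequences\<close>

text \<open>Domination of both ends is built into the relation, so that a TS-sequence becomes a path
  of \<open>slide\<close> and the theory of reflexive transitive closures applies.\<close>

definition slide :: "'a pair_pre_digraph \<Rightarrow> nat \<Rightarrow> 'a set \<Rightarrow> 'a set \<Rightarrow> bool" where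
  "slide G r A B \<longleftrightarrow> is_DrDS G r A \<and> is_DrDS G r B \<and>
     (\<exists>x y. A - B = {x} \<and> B - A = {y} \<and> (x, y) \<in> parcs G)"

text \<open>Every set on a nonempty path is certified by an adjacent slide; the conjunct
  \<open>is_DrDS G r A\<close> accounts for the sequence of length 0.\<close>

lemma TS_reconfigurable_iff_rtranclp:
  "TS_reconfigurable G r A B \<longleftrightarrow> is_DrDS G r A \<and> (slide G r)\<^sup>*\<^sup>* A B"
proof
  assume "TS_reconfigurable G r A B"
  then obtain q D where D: "TS_sequence G r A B q D"
    unfolding TS_reconfigurable_def by blast
  have "slide G r (D i) (D (Suc i))" if "i < q" for i
    using D that unfolding TS_sequence_def slide_def by auto
  moreover have "D 0 = A" "D q = B" "is_DrDS G r A"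
    using D unfolding TS_sequence_def by auto
  ultimately have "(slide G r ^^ q) A B"
    unfolding relpowp_fun_conv by blast
  then show "is_DrDS G r A \<and> (slide G r)\<^sup>*\<^sup>* A B"
    using \<open>is_DrDS G r A\<close> relpowp_imp_rtranclp by metis
next
  assume "is_DrDS G r A \<and> (slide G r)\<^sup>*\<^sup>* A B"
  then have A: "is_DrDS G r A" and "(slide G r)\<^sup>*\<^sup>* A B" by auto
  then obtain q where "(slide G r ^^ q) A B"
    using rtranclp_imp_relpowp by metis
  then obtain D where D: "D 0 = A" "D q = B" "\<And>i. i < q \<Longrightarrow> slide G r (D i) (D (Suc i))"
    unfolding relpowp_fun_conv by blast
  have "is_DrDS G r (D i)" if "i \<le> q" for i
    using that D A by (cases i) (auto simp: slide_def)
  then have "TS_sequence G r A B q D"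
    using D unfolding TS_sequence_def slide_def by blast
  then show "TS_reconfigurable G r A B"
    unfolding TS_reconfigurable_def by blast
qed

lemma TS_reconfigurable_refl: "is_DrDS G r A \<Longrightarrow> TS_reconfigurable G r A A"
  by (simp add: TS_reconfigurable_iff_rtranclp)

lemma TS_reconfigurable_trans:
  "TS_reconfigurable G r A B \<Longrightarrow> TS_reconfigurable G r B C \<Longrightarrow> TS_reconfigurable G r A C"
  by (auto simp: TS_reconfigurable_iff_rtranclp)

lemma TS_reconfigurable_sym:
  assumes "pair_graph G" "TS_reconfigurable G r A B"
  shows "TS_reconfigurable G r B A"
proof -
  interpret pair_graph G by fact
  have "slide G r Y X" if "slide G r X Y" for X Y
    using that arcs_symmetric unfolding slide_def by blast
  then have "symp (slide G r)\<^sup>*\<^sup>*"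
    by (intro symp_rtranclp sympI)
  moreover have "(slide G r)\<^sup>*\<^sup>* A B"
    using assms(2) by (simp add: TS_reconfigurable_iff_rtranclp)
  ultimately have "(slide G r)\<^sup>*\<^sup>* B A"
    by (rule sympD)
  moreover have "is_DrDS G r B"
    using assms(2) unfolding TS_reconfigurable_def TS_sequence_def by auto
  ultimately show ?thesis
    by (simp add: TS_reconfigurable_iff_rtranclp)
qed

lemma TS_reconfigurable_slide:
  assumes "is_DrDS G r A" "is_DrDS G r (insert y (A - {x}))"
    and "x \<in> A" "y \<notin> A" "(x, y) \<in> parcs G"
  shows "TS_reconfigurable G r A (insert y (A - {x}))"
proof -
  have "A - insert y (A - {x}) = {x}" "insert y (A - {x}) - A = {y}"
    using assms by auto
  then have "slide G r A (insert y (A - {x}))"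
    using assms unfolding slide_def by blast
  then show ?thesis
    using assms by (simp add: TS_reconfigurable_iff_rtranclp)
qed

text \<open>A slide trades one vertex for one other, and all sets involved are finite. This is the
  necessary condition that the machine will test.\<close>

lemma TS_reconfigurable_imp_card_eq:
  assumes "pair_graph G" "TS_reconfigurable G r A B"
  shows "card A = card B"
proof -
  interpret pair_graph G by fact
  have step: "card X = card Y" if XY: "slide G r X Y" for X Y
  proof -
    obtain x y where xy: "X - Y = {x}" "Y - X = {y}"
      using XY unfolding slide_def by blast
    have "finite X" "finite Y"
      using XY finite_subset[OF _ pair_finite_verts] by (auto simp: slide_def is_DrDS_def)
    then have "card X = card (X \<inter> Y) + card (X - Y)" "card Y = card (X \<inter> Y) + card (Y - X)"
      by (metis card_Int_Diff add.commute, metis card_Int_Diff Int_commute)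
    then show ?thesis using xy by simp
  qed
  have "(slide G r)\<^sup>*\<^sup>* A B"
    using assms(2) by (simp add: TS_reconfigurable_iff_rtranclp)
  then show ?thesis
    by induction (use step in auto)
qed

section \<open>Split graphs\<close>

lemma (in pair_wf_digraph) graph_dist_le_length:
  assumes "awalk u p v"
  shows "graph_dist G u v \<le> ereal (real (length p))"
proof -
  have "awalk_cost (\<lambda>_. 1) p = real (length p)"
    by (induction p) auto
  then show ?thesis
    unfolding graph_dist_def \<mu>_def using assms by (intro INF_lower2[of p]) auto
qed

text \<open>Connectedness enters only through \<open>neighbour_in_K\<close>, which together with
  \<open>K_nonempty\<close> is derived later for connected split graphs with at least two
  vertices.\<close>

locale dominated_split_graph = pair_graph G for G :: "'a pair_pre_digraph" +
  fixes K S :: "'a set" and r :: nat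
  assumes split: "split_partition G K S"
    and K_nonempty: "K \<noteq> {}"
    and neighbour_in_K: "s \<in> S \<Longrightarrow> \<exists>z\<in>K. (s, z) \<in> parcs G"
    and two_le_r: "2 \<le> r"
begin

abbreviation reconf :: "'a set \<Rightarrow> 'a set \<Rightarrow> bool" (infix \<open>\<leadsto>\<close> 50) where
  "A \<leadsto> B \<equiv> TS_reconfigurable G r A B"

lemma verts_eq: "pverts G = K \<union> S" and K_S_disjoint: "K \<inter> S = {}"
  using split by (auto simp: split_partition_def)

lemma K_adjacent: "u \<in> K \<Longrightarrow> v \<in> K \<Longrightarrow> u \<noteq> v \<Longrightarrow> (u, v) \<in> parcs G"
  using split by (auto simp: split_partition_def clique_def)

section \<open>Sufficient conditions for domination\<close>

lemma is_DrDS_if_short_walks: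
  assumes "D \<subseteq> pverts G"
    and "\<And>v. v \<in> pverts G \<Longrightarrow> \<exists>u\<in>D. \<exists>p. awalk u p v \<and> length p \<le> 2"
  shows "is_DrDS G r D"
  unfolding is_DrDS_def
proof (intro conjI ballI)
  fix v assume "v \<in> pverts G"
  then obtain u p where "u \<in> D" "awalk u p v" "length p \<le> 2"
    using assms(2) by blast
  moreover have "ereal (real (length p)) \<le> ereal (real r)"
    using \<open>length p \<le> 2\<close> two_le_r by simp
  ultimately show "\<exists>u\<in>D. graph_dist G u v \<le> ereal (real r)"
    using graph_dist_le_length order_trans by blast
qed (fact assms(1))

text \<open>At most one step inside the clique reaches a neighbour of \<open>v\<close> in
  \<open>K\<close>, and one more step reaches \<open>v\<close>.\<close>

lemma short_walk_from_K:
  assumes "u \<in> K" "v \<in> pverts G"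
  shows "\<exists>p. awalk u p v \<and> length p \<le> 2"
proof -
  have K: "\<exists>p. awalk u p z \<and> length p \<le> 1" if "z \<in> K" for z
  proof (cases "u = z")
    case True
    then have "awalk u [] z" using assms verts_eq by (simp add: awalk_Nil_iff)
    then show ?thesis by force
  next
    case False
    then have "awalk u [(u, z)] z"
      using that assms verts_eq by (simp add: awalk_simps K_adjacent)
    then show ?thesis by force
  qed
  show ?thesis
  proof (cases "v \<in> K")
    case True
    then show ?thesis using K by fastforce
  next
    case False
    then obtain z where z: "z \<in> K" "(z, v) \<in> parcs G"
      using assms verts_eq neighbour_in_K arcs_symmetric by blast
    obtain p where p: "awalk u p z" "length p \<le> 1"
      using K[OF z(1)] by blast
    have "awalk z [(z, v)] v"
      using z assms by (simp add: awalk_simps)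
    then have "awalk u (p @ [(z, v)]) v"
      using p by (intro awalk_appendI)
    then show ?thesis using p by (intro exI[of _ "p @ [(z, v)]"]) auto
  qed
qed

lemma is_DrDS_if_meets_K:
  assumes "D \<subseteq> pverts G" "D \<inter> K \<noteq> {}"
  shows "is_DrDS G r D"
  using assms short_walk_from_K by (intro is_DrDS_if_short_walks) blast+

text \<open>Here the graph is a star with centre \<open>z\<close>, so any two vertices are at
  distance at most 2. This covers intermediate sets whose only clique token has left
  \<open>K\<close>.\<close>

lemma is_DrDS_if_K_singleton:
  assumes "K = {z}" "D \<subseteq> pverts G" "D \<noteq> {}"
  shows "is_DrDS G r D"
proof (cases "D \<inter> K = {}")
  case True
  then obtain u where u: "u \<in> D" "u \<in> S"
    using assms verts_eq by auto
  then have uz: "(u, z) \<in> parcs G"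
    using neighbour_in_K assms(1) by blast
  have "\<exists>p. awalk u p v \<and> length p \<le> 2" if v: "v \<in> pverts G" for v
  proof (cases "v = z")
    case True
    then have "awalk u [(u, z)] v" using uz v by (simp add: awalk_simps)
    then show ?thesis by force
  next
    case False
    then have "(z, v) \<in> parcs G"
      using neighbour_in_K assms(1) v verts_eq arcs_symmetric by blast
    then have "awalk u [(u, z), (z, v)] v" using uz v by (simp add: awalk_simps)
    then show ?thesis by force
  qed
  then show ?thesis using u assms by (intro is_DrDS_if_short_walks) blast+
qed (use assms is_DrDS_if_meets_K in blast)

section \<open>Exchanging one token for an unoccupied vertex\<close>

lemma slide_meeting_K:
  assumes "D \<subseteq> pverts G" "x \<in> D" "y \<notin> D" "(x, y) \<in> parcs G"
    and "D \<inter> K \<noteq> {}" "insert y (D - {x}) \<inter> K \<noteq> {}"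
  shows "D \<leadsto> insert y (D - {x})"
proof -
  have "y \<in> pverts G" using assms(4) in_arcsD2 by blast
  then show ?thesis
    using assms by (intro TS_reconfigurable_slide is_DrDS_if_meets_K) auto
qed

text \<open>The token on \<open>x\<close> travels through a neighbour \<open>z\<close> of
  \<open>y\<close> in \<open>K\<close>. If \<open>z\<close> is occupied, its token moves to
  \<open>y\<close> first and the token on \<open>x\<close> then replaces it; tokens are
  indistinguishable, so the resulting set is the same.\<close>

lemma exchange_K_S:
  assumes D: "D \<subseteq> pverts G" and x: "x \<in> D" "x \<in> K" and y: "y \<notin> D" "y \<in> S"
    and meets: "insert y (D - {x}) \<inter> K \<noteq> {}"
  shows "D \<leadsto> insert y (D - {x})"
proof -
  obtain z where z: "z \<in> K" "(z, y) \<in> parcs G"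
    using neighbour_in_K y arcs_symmetric by blast
  have yz: "y \<noteq> z" "y \<noteq> x" using y x z K_S_disjoint by auto
  consider "z = x" | "z \<noteq> x" "z \<notin> D" | "z \<noteq> x" "z \<in> D" by blast
  then show ?thesis
  proof cases
    case 1
    then show ?thesis using assms z by (intro slide_meeting_K) auto
  next
    case 2
    let ?E = "insert z (D - {x})"
    have eq: "insert y (?E - {z}) = insert y (D - {x})" using 2 by auto
    have "D \<leadsto> ?E"
      using 2 D x z by (intro slide_meeting_K K_adjacent) auto
    moreover have "?E \<leadsto> insert y (?E - {z})"
      using 2 D y z yz meets eq verts_eq by (intro slide_meeting_K) auto
    ultimately show ?thesis using eq TS_reconfigurable_trans by metis
  next
    case 3
    let ?E = "insert y (D - {z})"
    have eq: "insert z (?E - {x}) = insert y (D - {x})" using 3 yz by auto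
    have "D \<leadsto> ?E"
      using 3 D x y z by (intro slide_meeting_K) auto
    moreover have "?E \<leadsto> insert z (?E - {x})"
      using 3 D x y z yz verts_eq by (intro slide_meeting_K K_adjacent) auto
    ultimately show ?thesis using eq TS_reconfigurable_trans by metis
  qed
qed

text \<open>This is \<open>exchange_K_S\<close> run backwards from the resulting set.\<close>

lemma exchange_S_K:
  assumes D: "D \<subseteq> pverts G" "D \<inter> K \<noteq> {}" and x: "x \<in> D" "x \<in> S" and y: "y \<notin> D" "y \<in> K"
  shows "D \<leadsto> insert y (D - {x})"
proof -
  let ?E = "insert y (D - {x})"
  have eq: "insert x (?E - {y}) = D" using x y by auto
  have "?E \<leadsto> insert x (?E - {y})"
    using D x y eq verts_eq K_S_disjoint by (intro exchange_K_S) auto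
  then show ?thesis using eq TS_reconfigurable_sym pair_graph_axioms by metis
qed

text \<open>A free clique vertex serves as an intermediate stop. If \<open>K\<close> is full, a
  neighbour \<open>z\<close> of \<open>x\<close> in \<open>K\<close> first gives up its token to
  \<open>y\<close>, and then \<open>x\<close> slides into the gap at \<open>z\<close>.\<close>

lemma exchange_S_S:
  assumes D: "D \<subseteq> pverts G" "D \<inter> K \<noteq> {}" and x: "x \<in> D" "x \<in> S" and y: "y \<notin> D" "y \<in> S"
  shows "D \<leadsto> insert y (D - {x})"
proof (cases "K \<subseteq> D")
  case False
  then obtain z where z: "z \<in> K" "z \<notin> D" by blast
  let ?E = "insert z (D - {x})"
  have eq: "insert y (?E - {z}) = insert y (D - {x})" using z by auto
  have "D \<leadsto> ?E" using assms z by (intro exchange_S_K)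
  moreover have "?E \<leadsto> insert y (?E - {z})"
    using assms z eq verts_eq K_S_disjoint by (intro exchange_K_S) auto
  ultimately show ?thesis using eq TS_reconfigurable_trans by metis
next
  case True
  obtain z where z: "z \<in> K" "(x, z) \<in> parcs G"
    using neighbour_in_K x by blast
  let ?E = "insert y (D - {z})"
  have neq: "x \<noteq> z" "y \<noteq> z" "x \<noteq> y" using x y z K_S_disjoint by auto
  have eq: "insert z (?E - {x}) = insert y (D - {x})" using z True neq by auto
  have E_sub: "?E \<subseteq> pverts G" using D y verts_eq by auto
  have F: "is_DrDS G r (insert z (?E - {x}))"
    using D y z verts_eq by (intro is_DrDS_if_meets_K) auto
  \<comment> \<open>Vacating \<open>z\<close> leaves \<open>K\<close> without tokens only when
    \<open>K = {z}\<close>. The graph is then a star, so \<open>?E\<close> still dominates and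
    \<open>z\<close> is adjacent to \<open>y\<close>.\<close>
  have "is_DrDS G r ?E \<and> D \<leadsto> ?E"
  proof (cases "K = {z}")
    case K: True
    then have zy: "(z, y) \<in> parcs G"
      using neighbour_in_K y arcs_symmetric by blast
    have "is_DrDS G r ?E"
      using K E_sub by (intro is_DrDS_if_K_singleton) auto
    moreover have "D \<leadsto> ?E"
      using calculation D True z y zy is_DrDS_if_meets_K
      by (intro TS_reconfigurable_slide) auto
    ultimately show ?thesis ..
  next
    case False
    then have "?E \<inter> K \<noteq> {}" using z True by blast
    then show ?thesis
      using E_sub D True z y is_DrDS_if_meets_K exchange_K_S[of D z y] by auto
  qed
  moreover have "?E \<leadsto> insert z (?E - {x})" if "is_DrDS G r ?E"
    using that F x z neq by (intro TS_reconfigurable_slide) auto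
  ultimately show ?thesis using eq TS_reconfigurable_trans by metis
qed

lemma exchange:
  assumes "D \<subseteq> pverts G" "D \<inter> K \<noteq> {}" "x \<in> D" "y \<in> pverts G" "y \<notin> D"
    and "insert y (D - {x}) \<inter> K \<noteq> {}"
  shows "D \<leadsto> insert y (D - {x})"
proof -
  have "x \<noteq> y" using assms by auto
  consider "x \<in> K" "y \<in> K" | "x \<in> K" "y \<in> S" | "x \<in> S" "y \<in> K" | "x \<in> S" "y \<in> S"
    using assms verts_eq by auto
  then show ?thesis
  proof cases
    case 1
    then show ?thesis using assms \<open>x \<noteq> y\<close> by (intro slide_meeting_K K_adjacent)
  next
    case 2
    then show ?thesis using assms by (intro exchange_K_S)
  next
    case 3
    then show ?thesis using assms by (intro exchange_S_K)
  next
    case 4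
    then show ?thesis using assms by (intro exchange_S_S)
  qed
qed

section \<open>Reaching a target of the same size\<close>

text \<open>Each exchange moves a token from \<open>A - B\<close> to a vertex of
  \<open>B - A\<close>, so the number of missing target vertices drops by one while \<open>K\<close>
  stays occupied.\<close>

lemma reconf_if_meets_K:
  assumes "A \<subseteq> pverts G" "A \<inter> K \<noteq> {}" "B \<subseteq> pverts G" "B \<inter> K \<noteq> {}" "card A = card B"
  shows "A \<leadsto> B"
  using assms
proof (induction "card (B - A)" arbitrary: A)
  case 0
  have fin: "finite A" "finite B"
    using 0 finite_subset[OF _ pair_finite_verts] by auto
  then have "B \<subseteq> A" using 0 by simp
  then have "A = B" using 0 fin card_subset_eq by metis
  then show ?case using 0 is_DrDS_if_meets_K TS_reconfigurable_refl by blast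
next
  case (Suc n)
  have fin: "finite A" "finite B"
    using Suc finite_subset[OF _ pair_finite_verts] by auto
  have "B - A \<noteq> {}" using Suc.hyps(2) by (metis card.empty nat.distinct(1))
  then have "\<not> A \<subseteq> B" using fin Suc.prems(5) card_subset_eq by blast
  then obtain x where x: "x \<in> A" "x \<notin> B" by blast
  \<comment> \<open>If \<open>x\<close> carries the only clique token of \<open>A\<close>, its
    replacement must lie in \<open>K\<close>. A clique vertex of \<open>B\<close> qualifies: it
    differs from \<open>x\<close>, which is not in \<open>B\<close>, and hence is not in
    \<open>A\<close>.\<close>
  obtain y where y: "y \<in> B" "y \<notin> A" "insert y (A - {x}) \<inter> K \<noteq> {}"
  proof (cases "(A - {x}) \<inter> K = {}")
    case True
    then have "B \<inter> K \<inter> A = {}" using x by blast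
    then obtain y where "y \<in> B" "y \<notin> A" "y \<in> K" using Suc.prems(4) by blast
    then show ?thesis using that by blast
  next
    case False
    then show ?thesis using that \<open>B - A \<noteq> {}\<close> by blast
  qed
  let ?A = "insert y (A - {x})"
  have "B - ?A = (B - A) - {y}" using x by auto
  then have "n = card (B - ?A)" using Suc.hyps(2) y fin by simp
  moreover have "card ?A = card B"
    using x y fin Suc.prems(5) by (simp add: card_Suc_Diff1 del: card_Diff_insert)
  ultimately have "?A \<leadsto> B"
    using Suc.prems y by (intro Suc.hyps(1)) auto
  moreover have "A \<leadsto> ?A"
    using Suc.prems x y by (intro exchange) auto
  ultimately show ?case using TS_reconfigurable_trans by metis
qed

lemma reconf_to_meet_K:
  assumes "is_DrDS G r D"
  shows "\<exists>E. D \<leadsto> E \<and> E \<subseteq> pverts G \<and> E \<inter> K \<noteq> {}"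
proof (cases "D \<inter> K = {}")
  case True
  have sub: "D \<subseteq> pverts G" using assms by (simp add: is_DrDS_def)
  have "D \<noteq> {}" using assms K_nonempty verts_eq by (auto simp: is_DrDS_def)
  then obtain s where s: "s \<in> D" "s \<in> S" using True sub verts_eq by auto
  then obtain z where z: "z \<in> K" "(s, z) \<in> parcs G" using neighbour_in_K by blast
  let ?E = "insert z (D - {s})"
  have E: "?E \<subseteq> pverts G" "?E \<inter> K \<noteq> {}" using sub z verts_eq by auto
  then have "D \<leadsto> ?E"
    using assms s z True is_DrDS_if_meets_K by (intro TS_reconfigurable_slide) auto
  then show ?thesis using E by blast
next
  case False
  then show ?thesis
    using assms TS_reconfigurable_refl[OF assms] by (auto simp: is_DrDS_def)
qed

text \<open>Both ends are first moved to sets meeting \<open>K\<close>; the moves for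
  \<open>B\<close> are then undone by symmetry.\<close>

lemma reconf_if_card_eq:
  assumes "is_DrDS G r A" "is_DrDS G r B" "card A = card B"
  shows "A \<leadsto> B"
proof -
  obtain A' where A': "A \<leadsto> A'" "A' \<subseteq> pverts G" "A' \<inter> K \<noteq> {}"
    using reconf_to_meet_K[OF assms(1)] by blast
  obtain B' where B': "B \<leadsto> B'" "B' \<subseteq> pverts G" "B' \<inter> K \<noteq> {}"
    using reconf_to_meet_K[OF assms(2)] by blast
  have "card A' = card B'"
    using A'(1) B'(1) assms(3) TS_reconfigurable_imp_card_eq[OF pair_graph_axioms] by metis
  then have "A' \<leadsto> B'" using A' B' by (intro reconf_if_meets_K)
  moreover have "B' \<leadsto> B" using TS_reconfigurable_sym[OF pair_graph_axioms B'(1)] .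
  ultimately show ?thesis using A'(1) TS_reconfigurable_trans by metis
qed

end

section \<open>Connected split graphs\<close>

text \<open>Arcs are symmetric, so connectedness yields a directed path from \<open>u\<close> to
  \<open>v\<close>; its first arc gives the neighbour.\<close>

lemma connected_has_neighbour:
  assumes "pair_graph G" "Digraph_Component.connected (with_proj G)"
    and "u \<in> pverts G" "v \<in> pverts G" "u \<noteq> v"
  shows "\<exists>w. (u, w) \<in> parcs G"
proof -
  interpret pair_graph G by fact
  have "strongly_connected (with_proj G)"
    using assms(2) pair_sym_arcs by (intro symmetric_connected_imp_strongly_connected)
  then have "u \<rightarrow>\<^sup>*\<^bsub>with_proj G\<^esub> v" using assms by auto
  then show ?thesis
    by (cases rule: converse_reachable_cases) (use assms in auto)
qed

lemma split_TS_reconfigurable: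
  assumes "pair_graph G" "Digraph_Component.connected (with_proj G)" "split_partition G K S"
    and "2 \<le> r" "is_DrDS G r A" "is_DrDS G r B" "card A = card B"
  shows "TS_reconfigurable G r A B"
proof -
  interpret pair_graph G by fact
  have sub: "A \<subseteq> pverts G" "B \<subseteq> pverts G" using assms by (auto simp: is_DrDS_def)
  have S: "S \<subseteq> pverts G" "pverts G = K \<union> S" "\<And>u v. u \<in> S \<Longrightarrow> v \<in> S \<Longrightarrow> (u, v) \<notin> parcs G"
    using assms(3) by (auto simp: split_partition_def independent_set_def)
  have ne: "pverts G \<noteq> {}"
    using assms(2) by (auto simp: Digraph_Component.connected_def strongly_connected_def)
  then obtain u where u: "u \<in> pverts G" by blast
  show ?thesis
  proof (cases "pverts G = {u}")
    \<comment> \<open>The one-vertex graph is treated separately because its partition may have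
      \<open>K = {}\<close>; its only dominating set is \<open>{u}\<close>.\<close>
    case True
    then have "A = {u}" "B = {u}" using assms(5,6) by (auto simp: is_DrDS_def)
    then show ?thesis using assms TS_reconfigurable_refl by blast
  next
    case False
    have nb: "\<exists>z\<in>K. (s, z) \<in> parcs G" if s: "s \<in> S" for s
    proof -
      obtain v where "v \<in> pverts G" "v \<noteq> s" using False u by blast
      then obtain z where z: "(s, z) \<in> parcs G"
        using connected_has_neighbour[OF assms(1,2), of s v] s S(1) by auto
      then show ?thesis using in_arcsD2[OF z] S(2) S(3)[OF s, of z] by auto
    qed
    then have "K \<noteq> {}" using S ne by blast
    then interpret dominated_split_graph G K S r
      using nb assms by unfold_locales auto
    show ?thesis using assms by (intro reconf_if_card_eq)
  qed
qed

section \<open>A linear-time machine comparing the two sizes\<close>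

text \<open>State 0 skips the adjacency matrix, state 3 reads \<open>D\<^sub>s\<close> and state 4 reads \<open>D\<^sub>t\<close>. The symbol 1
  marks the origin of the second tape; its head moves right for every element of \<open>D\<^sub>s\<close> and left
  for every element of \<open>D\<^sub>t\<close>.\<close>

definition counter_move :: "nat \<Rightarrow> nat \<Rightarrow> move" where
  "counter_move q s =
     (if s = 2 \<and> q = 3 then MoveRight else if s = 2 \<and> q = 4 then MoveLeft else Stay)"

definition next_state :: "nat \<Rightarrow> nat \<Rightarrow> nat \<Rightarrow> nat" where
  "next_state q s t =
     (if s \<noteq> 4 then q else if q = 0 then 3 else if q = 3 then 4 else if t = 1 then 1 else 2)"

definition compare_tm :: tm where
  "compare_tm = \<lparr>ntapes = 2, nsymbols = 5, nstates = 5,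
     delta = (\<lambda>q xs. (next_state q (xs ! 0) (xs ! 1),
       [(xs ! 0, MoveRight),
        (if q = 0 \<and> xs ! 0 = 4 then 1 else xs ! 1, counter_move q (xs ! 0))]))\<rparr>"

lemma wf_compare_tm: "wf_tm compare_tm"
proof -
  have "xs ! 0 < 5 \<and> xs ! 1 < 5" if "length xs = 2" "set xs \<subseteq> {..<5}" for xs :: "nat list"
    using that by (auto simp: numeral_2_eq_2 length_Suc_conv)
  then show ?thesis
    by (auto simp: wf_tm_def compare_tm_def next_state_def)
qed

text \<open>The first head writes back the symbol it reads, so the input tape never changes and its
  head position is the length of the prefix already read.\<close>

lemma compare_tm_step:
  assumes "w = u @ s # v" "q \<noteq> 1" "q \<noteq> 2"
  shows "tm_step compare_tm (q, [(fst (input_tape w), int (length u)), (g, c)]) =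
    (next_state q s (g c),
      [(fst (input_tape w), int (Suc (length u))),
       (g(c := if q = 0 \<and> s = 4 then 1 else g c), c + offset (counter_move q s))])"
proof -
  have "fst (input_tape w) (int (length u)) = s"
    using assms by (simp add: input_tape_def)
  then show ?thesis
    using assms
    by (simp add: tm_step_def halted_def compare_tm_def read_tape_def write_move_def fun_upd_idem
        add.commute)
qed

text \<open>Without the symbol 4 the state is constant and the second tape is not altered; only the
  symbol 2 can move the counter, always by the same offset.\<close>

lemma compare_tm_segment:
  assumes "w = u @ v @ x" "4 \<notin> set v" "q \<noteq> 1" "q \<noteq> 2"
  shows "(tm_step compare_tm ^^ length v) (q, [(fst (input_tape w), int (length u)), (g, c)]) =
    (q, [(fst (input_tape w), int (length (u @ v))),
         (g, c + offset (counter_move q 2) * int (count_list v 2))])"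
  using assms
proof (induction v arbitrary: u c)
  case Nil
  then show ?case by simp
next
  case (Cons s v)
  have "(tm_step compare_tm ^^ length (s # v)) (q, [(fst (input_tape w), int (length u)), (g, c)]) =
    (tm_step compare_tm ^^ length v) (tm_step compare_tm
      (q, [(fst (input_tape w), int (length u)), (g, c)]))"
    by (simp add: funpow_swap1)
  also have "\<dots> = (tm_step compare_tm ^^ length v)
      (q, [(fst (input_tape w), int (length (u @ [s]))), (g, c + offset (counter_move q s))])"
    using Cons.prems by (subst compare_tm_step[of _ _ s "v @ x"]) (auto simp: next_state_def)
  also have "\<dots> = (q, [(fst (input_tape w), int (length ((u @ [s]) @ v))),
      (g, c + offset (counter_move q s) + offset (counter_move q 2) * int (count_list v 2))])"
    using Cons.prems by (intro Cons.IH) auto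
  also have "c + offset (counter_move q s) + offset (counter_move q 2) * int (count_list v 2) =
      c + offset (counter_move q 2) * int (count_list (s # v) 2)"
    by (auto simp: counter_move_def algebra_simps)
  finally show ?case by simp
qed

text \<open>A segment followed by its terminator 4, which changes the state and, in state 0, writes
  the mark under the second head.\<close>

lemma compare_tm_block:
  assumes "w = u @ v @ 4 # x" "4 \<notin> set v" "q \<noteq> 1" "q \<noteq> 2"
    and "d = c + offset (counter_move q 2) * int (count_list v 2)"
  shows "(tm_step compare_tm ^^ Suc (length v))
      (q, [(fst (input_tape w), int (length u)), (g, c)]) =
    (next_state q 4 (g d),
      [(fst (input_tape w), int (length (u @ v @ [4]))), (g(d := if q = 0 then 1 else g d), d)])"
proof -
  have off: "offset (counter_move q 4) = 0" by (simp add: counter_move_def)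
  have "(tm_step compare_tm ^^ Suc (length v))
      (q, [(fst (input_tape w), int (length u)), (g, c)]) =
    tm_step compare_tm (q, [(fst (input_tape w), int (length (u @ v))), (g, d)])"
    using assms by (simp add: compare_tm_segment)
  also have "\<dots> = (next_state q 4 (g d),
      [(fst (input_tape w), int (length (u @ v @ [4]))), (g(d := if q = 0 then 1 else g d), d)])"
    using assms by (subst compare_tm_step[of _ _ 4 x]) (auto simp: off)
  finally show ?thesis .
qed

text \<open>The second tape is blank except for the mark at position 0. The second head ends at the
  difference of the two counts, so it reads 1 at the last terminator exactly when they
  agree.\<close>

lemma compare_tm_run:
  assumes "4 \<notin> set a" "4 \<notin> set b" "4 \<notin> set c"
    and w: "w = a @ [4] @ b @ [4] @ c @ [4]"
  shows "fst (tm_run compare_tm w (length w)) = (if count_list b 2 = count_list c 2 then 1 else 2)"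
proof -
  let ?f = "fst (input_tape w)" and ?run = "\<lambda>v. tm_step compare_tm ^^ Suc (length v)"
  let ?g = "(\<lambda>_. 0)(0 := 1)" and ?b = "int (count_list b 2)"
  let ?d = "?b - int (count_list c 2)"
  have init: "tm_init compare_tm w = (0, [(?f, int (length ([] :: nat list))), (\<lambda>_. 0, 0)])"
    by (auto simp: tm_init_def compare_tm_def input_tape_def numeral_2_eq_2)
  have "?run a (tm_init compare_tm w) = (3, [(?f, int (length (a @ [4]))), (?g, 0)])"
    unfolding init using assms
    by (subst compare_tm_block[of _ _ _ "b @ [4] @ c @ [4]" _ 0])
       (auto simp: next_state_def counter_move_def)
  moreover have "?run b (3, [(?f, int (length (a @ [4]))), (?g, 0)]) =
      (4, [(?f, int (length (a @ [4] @ b @ [4]))), (?g, ?b)])"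
    using assms
    by (subst compare_tm_block[of _ _ _ "c @ [4]" _ ?b])
       (auto simp: next_state_def counter_move_def)
  moreover have "fst (?run c (4, [(?f, int (length (a @ [4] @ b @ [4]))), (?g, ?b)])) =
      (if count_list b 2 = count_list c 2 then 1 else 2)"
    using assms
    by (subst compare_tm_block[of _ _ _ "[]" _ ?d])
       (auto simp: next_state_def counter_move_def)
  moreover have "tm_run compare_tm w (length w) = ?run c (?run b (?run a (tm_init compare_tm w)))"
  proof -
    \<comment> \<open>The summands are in reverse order because \<open>funpow_add\<close> applies
      the right summand first.\<close>
    have "length w = Suc (length c) + (Suc (length b) + Suc (length a))"
      using w by simp
    then show ?thesis by (simp only: tm_run_def funpow_add comp_apply)
  qed
  ultimately show ?thesis by (simp only:)
qed

section \<open>Running the machine on encoded instances\<close>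

lemma count_list_encode_vertex_set:
  assumes "D \<subseteq> {..<n}"
  shows "count_list (encode_vertex_set n D) 2 = card D"
proof -
  have "count_list (map (\<lambda>v. bit_symbol (v \<in> D)) xs) 2 = length (filter (\<lambda>v. v \<in> D) xs)" for xs
    by (induction xs) (auto simp: bit_symbol_def)
  then have "count_list (encode_vertex_set n D) 2 = length (filter (\<lambda>v. v \<in> D) [0..<n])"
    by (simp add: encode_vertex_set_def)
  also have "\<dots> = card (set (filter (\<lambda>v. v \<in> D) [0..<n]))"
    by (metis distinct_card distinct_filter distinct_upt)
  also have "set (filter (\<lambda>v. v \<in> D) [0..<n]) = D"
    using assms by auto
  finally show ?thesis .
qed

lemma set_encode_graph: "set (encode_graph G) \<subseteq> {1, 2, 3}"
  by (auto simp: encode_graph_def bit_symbol_def Let_def)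

lemma set_encode_vertex_set: "set (encode_vertex_set n D) \<subseteq> {1, 2}"
  by (auto simp: encode_vertex_set_def bit_symbol_def)

lemma split_DrDSR_poly_time:
  assumes "2 \<le> r"
  shows "split_DrDSR_poly_time r"
  unfolding split_DrDSR_poly_time_def poly_time_solvable_def
\<comment> \<open>The time bound is the polynomial \<open>X\<close>: one pass over the input, one
  step per symbol.\<close>
proof (rule exI[of _ compare_tm], rule exI[of _ "[:0, 1:]"], intro conjI ballI)
  show "wf_tm compare_tm" by (rule wf_compare_tm)
next
  fix I assume "I \<in> split_DrDSR_instances r"
  then obtain G n A B K S where I: "I = (G, A, B)" and G: "pair_graph G" "pverts G = {..<n}"
      "Digraph_Component.connected (with_proj G)" "split_partition G K S"
    and AB: "is_DrDS G r A" "is_DrDS G r B"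
    by (auto simp: split_DrDSR_instances_def split_graph_def)
  \<comment> \<open>Sufficiency of equal sizes uses the split structure and
    \<open>2 \<le> r\<close>; necessity holds in every graph.\<close>
  have iff: "TS_reconfigurable G r A B \<longleftrightarrow> card A = card B"
    using G AB assms split_TS_reconfigurable TS_reconfigurable_imp_card_eq by blast
  define w where "w = encode_DrDSR I"
  have w: "w = encode_graph G @ [4] @ encode_vertex_set n A @ [4] @ encode_vertex_set n B @ [4]"
    using G by (simp add: w_def I encode_DrDSR_def)
  show "set (encode_DrDSR I) \<subseteq> {0<..<nsymbols compare_tm}"
    using set_encode_graph[of G] set_encode_vertex_set[of n A] set_encode_vertex_set[of n B]
    unfolding w_def[symmetric] w by (auto simp: compare_tm_def)
  have "A \<subseteq> {..<n}" "B \<subseteq> {..<n}" using G AB by (auto simp: is_DrDS_def)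
  moreover have "4 \<notin> set (encode_graph G)" "4 \<notin> set (encode_vertex_set n A)"
      "4 \<notin> set (encode_vertex_set n B)"
    using set_encode_graph[of G] set_encode_vertex_set[of n A] set_encode_vertex_set[of n B]
    by force+
  ultimately have run: "fst (tm_run compare_tm w (length w)) = (if card A = card B then 1 else 2)"
    using compare_tm_run[OF _ _ _ w] by (simp add: count_list_encode_vertex_set)
  then have "halted (tm_run compare_tm w (length w))"
    by (simp add: halted_def)
  moreover have "length w \<le> poly [:0, 1:] (length w)" by simp
  ultimately show "\<exists>t\<le>poly [:0, 1:] (length (encode_DrDSR I)).
      halted (tm_run compare_tm (encode_DrDSR I) t) \<and>
      (fst (tm_run compare_tm (encode_DrDSR I) t) = 1 \<longleftrightarrow>
        (case I of (G, Ds, Dt) \<Rightarrow> TS_reconfigurable G r Ds Dt))"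
    unfolding w_def[symmetric] using run iff by (intro exI[of _ "length w"]) (auto simp: I)
qed

theorem theorem8:
  shows "(\<forall>r\<ge>2. split_DrDSR_poly_time r) \<and>
    (\<forall>(G :: 'a pair_pre_digraph) K S Ds Dt k.
       pair_graph G \<and> Digraph_Component.connected (with_proj G) \<and> split_partition G K S \<and>
       is_DrDS G 2 Ds \<and> is_DrDS G 2 Dt \<and> card Ds = k \<and> card Dt = k \<longrightarrow>
       (\<exists>q D. TS_sequence G 2 Ds Dt q D))"
proof (intro conjI allI impI)
  fix r :: nat assume "2 \<le> r"
  then show "split_DrDSR_poly_time r" by (rule split_DrDSR_poly_time)
next
  fix G :: "'a pair_pre_digraph" and K S Ds Dt k
  assume "pair_graph G \<and> Digraph_Component.connected (with_proj G) \<and> split_partition G K S \<and>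
    is_DrDS G 2 Ds \<and> is_DrDS G 2 Dt \<and> card Ds = k \<and> card Dt = k"
  then have "TS_reconfigurable G 2 Ds Dt"
    by (intro split_TS_reconfigurable[of G K S]) auto
  then show "\<exists>q D. TS_sequence G 2 Ds Dt q D"
    unfolding TS_reconfigurable_def .
qed

end
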